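(* Let $n\ge1$, let $\mu$ be a probability distribution on the Boolean cube $I_n=\{0,1\}^n$, and let $t>0$. Suppose $y=(y_k)_{k=1}^n\in I_n$ is such that the positive correlation condition holds for all $2\le k\le n$, i.e. for every $2\le k\le n$, with $y'=(y_1,\dots,y_{k-1})$, $$\int_{I_{k-1}}a_{k-1}(x',y',t)\,\mu(x_k=y_k\mid x')\,d\mu_{k-1}(x')\;\ge\;\int_{I_{k-1}}a_{k-1}(x',y',t)\,d\mu_{k-1}(x')\int_{I_{k-1}}\mu(x_k=y_k\mid x')\,d\mu_{k-1}(x').$$ Then $$\int_{I_n}e^{t\left(d_H(x,y)-\mathbf{E}_\mu d_H(x,y)\right)}\,d\mu(x)\le e^{nt^2/2}.$$
   Context: $I_n=\{0,1\}^n$ and $d_H(x,y)=\sum_{i}|x_i-y_i|$ is the Hamming distance (used on $I_k$ for every $k$). Let $(x_1,\dots,x_n)$ be a random vector with distribution $\mu$. For $1\le k\le n$, $\mu_k$ denotes the joint distribution of $(x_1,\dots,x_k)$ on $I_k$. For $2\le k\le n$ and $x'=(x_1,\dots,x_{k-1})\in I_{k-1}$, $\mu(x_k=y_k\mid x')$ is the conditional probability under $\mu$ that the $k$-th coordinate equals $y_k$ given that the first $k-1$ coordinates are $x'$ (its value at points $x'$ with $\mu_{k-1}(x')=0$ is irrelevant). For $x',y'\in I_{k-1}$, $$a_{k-1}(x',y',t):=e^{t\left(d_H(x',y')-\mathbf{E}_{\mu_{k-1}}d_H(x',y')\right)}.$$ All expectations are over $x$ (or $x'$), with $y$ fixed.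 *)

theory Defs
  imports "HOL-Probability.Probability"
begin

text \<open>
  Points of the cube are Boolean lists; the coordinate \<open>x\<^sub>i\<close> (\<open>1 \<le> i \<le> n\<close>) is \<open>x ! (i - 1)\<close>, and
  the prefix \<open>(x\<^sub>1, \<dots>, x\<^sub>k)\<close> is \<open>take k x\<close>.
\<close>

definition cube :: "nat \<Rightarrow> bool list set" where
  "cube n = {x. length x = n}"

text \<open>Only meaningful for lists of the same length.\<close>

definition hamming :: "bool list \<Rightarrow> bool list \<Rightarrow> real" where
  "hamming x y = (\<Sum>i<length x. \<bar>of_bool (x ! i) - of_bool (y ! i)\<bar>)"

definition marginal :: "bool list pmf \<Rightarrow> nat \<Rightarrow> bool list pmf" where
  "marginal \<mu> k = map_pmf (take k) \<mu>"

text \<open>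
  The probability that the \<open>k\<close>-th coordinate (\<open>k \<ge> 1\<close>) equals \<open>b\<close>, given that the first \<open>k - 1\<close>
  coordinates are \<open>x'\<close>; it is \<open>0\<close> when the conditioning event is null.
\<close>

definition cond_coord :: "bool list pmf \<Rightarrow> nat \<Rightarrow> bool \<Rightarrow> bool list \<Rightarrow> real" where
  "cond_coord \<mu> k b x' =
     cond_prob (measure_pmf \<mu>) (\<lambda>x. x ! (k - 1) = b) (\<lambda>x. take (k - 1) x = x')"

text \<open>For a law \<open>\<nu>\<close> on a cube, the exponential of the centred Hamming distance to \<open>y\<close>.\<close>

definition exp_dev :: "bool list pmf \<Rightarrow> real \<Rightarrow> bool list \<Rightarrow> bool list \<Rightarrow> real" where
  "exp_dev \<nu> t y x =
     exp (t * (hamming x y - measure_pmf.expectation \<nu> (\<lambda>z. hamming z y)))"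

definition positive_correlation :: "bool list pmf \<Rightarrow> real \<Rightarrow> bool list \<Rightarrow> nat \<Rightarrow> bool" where
  "positive_correlation \<mu> t y k \<longleftrightarrow>
     (let \<nu> = marginal \<mu> (k - 1);
          a = exp_dev \<nu> t (take (k - 1) y);
          q = cond_coord \<mu> k (y ! (k - 1))
      in measure_pmf.expectation \<nu> (\<lambda>x'. a x' * q x')
           \<ge> measure_pmf.expectation \<nu> a * measure_pmf.expectation \<nu> q)"

end

theory Submission
  imports Defs
begin

text \<open>
  Induction on the length of the prefix. Adding the coordinate \<open>x\<^sub>k\<close> multiplies the exponential by
  \<open>exp (t * (of_bool (x\<^sub>k \<noteq> y\<^sub>k) - P (x\<^sub>k \<noteq> y\<^sub>k)))\<close>, which is a decreasing affine function of
  \<open>of_bool (x\<^sub>k = y\<^sub>k)\<close> because \<open>t > 0\<close>. Positive correlation therefore bounds the expectation of the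
  product by the product of the expectations, and Hoeffding's lemma bounds the new factor by
  \<open>exp (t\<^sup>2 / 8)\<close>. For the first coordinate the correlation condition is an equality.
\<close>

lemma expectation_of_bool:
  "measure_pmf.expectation p (\<lambda>x. of_bool (P x)) = measure_pmf.prob p {x. P x}"
proof -
  have "measure_pmf.expectation p (\<lambda>x. of_bool (P x))
      = measure_pmf.expectation p (indicator {x. P x} :: _ \<Rightarrow> real)"
    by (intro Bochner_Integration.integral_cong) (auto simp: indicator_def)
  then show ?thesis
    by simp
qed

text \<open>Tower property, by summing over the fibres of \<open>f\<close>. With
  \<open>f = take k\<close> it turns the conditional probabilities in the correlation condition into
  plain expectations under \<mu>.\<close>

lemma expectation_map_pmf_cond_prob:
  fixes g :: "'b \<Rightarrow> real"
  assumes fin: "finite (set_pmf p)"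
  shows "measure_pmf.expectation (map_pmf f p)
           (\<lambda>z. g z * cond_prob (measure_pmf p) P (\<lambda>x. f x = z))
         = measure_pmf.expectation p (\<lambda>x. g (f x) * of_bool (P x))"
proof -
  have measure_eq: "measure_pmf.prob p {x. Q x} = (\<Sum>x\<in>set_pmf p. pmf p x * of_bool (Q x))" for Q
    unfolding expectation_of_bool[symmetric] by (subst integral_measure_pmf[OF fin]) auto
  have cond: "pmf (map_pmf f p) z * cond_prob (measure_pmf p) P (\<lambda>x. f x = z)
      = (\<Sum>x\<in>{x\<in>set_pmf p. f x = z}. pmf p x * of_bool (P x))" if "z \<in> f ` set_pmf p" for z
  proof -
    have *: "pmf (map_pmf f p) z = measure_pmf.prob p {x. f x = z}"
      by (simp add: pmf_map vimage_def)
    \<comment> \<open>The fibre over \<open>z\<close> meets the support, so the denominator of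
      \<open>cond_prob\<close> cancels and its default value 0 never enters.\<close>
    have "pmf (map_pmf f p) z \<noteq> 0"
      using that by (simp add: set_pmf_iff[symmetric])
    then have "pmf (map_pmf f p) z * cond_prob (measure_pmf p) P (\<lambda>x. f x = z)
        = measure_pmf.prob p {x. P x \<and> f x = z}"
      unfolding cond_prob_def using * by simp
    also have "\<dots> = (\<Sum>x\<in>{x\<in>set_pmf p. f x = z}. pmf p x * of_bool (P x))"
      unfolding measure_eq by (subst sum.inter_filter[OF fin]) (auto intro!: sum.cong)
    finally show ?thesis .
  qed
  have "measure_pmf.expectation (map_pmf f p)
           (\<lambda>z. g z * cond_prob (measure_pmf p) P (\<lambda>x. f x = z))
      = (\<Sum>z\<in>f ` set_pmf p. g z * (pmf (map_pmf f p) z * cond_prob (measure_pmf p) P (\<lambda>x. f x = z)))"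
    using fin by (subst integral_measure_pmf[of "f ` set_pmf p"]) (auto simp: mult_ac)
  also have "\<dots> = (\<Sum>z\<in>f ` set_pmf p. \<Sum>x\<in>{x\<in>set_pmf p. f x = z}. pmf p x * (g (f x) * of_bool (P x)))"
    by (intro sum.cong refl) (auto simp: cond sum_distrib_left mult_ac intro!: sum.cong)
  also have "\<dots> = (\<Sum>x\<in>set_pmf p. pmf p x * (g (f x) * of_bool (P x)))"
    by (rule sum.image_gen[OF fin, symmetric])
  also have "\<dots> = measure_pmf.expectation p (\<lambda>x. g (f x) * of_bool (P x))"
    by (subst integral_measure_pmf[OF fin]) auto
  finally show ?thesis .
qed

lemma hamming_take_Suc:
  assumes "k < length x" "k < length y"
  shows "hamming (take (Suc k) x) (take (Suc k) y)
         = hamming (take k x) (take k y) + of_bool (x ! k \<noteq> y ! k)"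
proof -
  have "length (take (Suc k) x) = Suc k" "length (take k x) = k"
    using assms by simp_all
  then show ?thesis
    unfolding hamming_def by (simp add: lessThan_Suc)
qed

text \<open>Hoeffding's lemma for a centred indicator: its values lie in [-m, 1 - m], where m is the
  probability of \<open>P\<close>. This interval has length 1, whence the constant 1/8.\<close>

lemma exp_centred_indicator_le:
  "measure_pmf.expectation p
     (\<lambda>x. exp (t * (of_bool (P x) - measure_pmf.prob p {x. P x}))) \<le> exp (t\<^sup>2 / 8)"
  if "t > 0"
proof -
  let ?X = "\<lambda>x. of_bool (P x) - measure_pmf.prob p {x. P x} :: real"
  have int: "integrable (measure_pmf p) (\<lambda>x. of_bool (P x) :: real)"
    by (rule measure_pmf.integrable_const_bound[where B = 1]) auto
  then have mean: "measure_pmf.expectation p ?X = 0"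
    by (simp add: expectation_of_bool)
  let ?m = "measure_pmf.prob p {x. P x}"
  interpret interval_bounded_random_variable "measure_pmf p" ?X "- ?m" "1 - ?m"
    by unfold_locales auto
  \<comment> \<open>Integrability lets the nonnegative integral bounded by Hoeffding's lemma be read
    as an expectation.\<close>
  have "integrable (measure_pmf p) (\<lambda>x. exp (t * ?X x))"
  proof (rule measure_pmf.integrable_const_bound[where B = "exp t"])
    have "?X x \<le> 1" for x
      by (rule order_trans[of _ "of_bool (P x)"]) auto
    then show "AE x in measure_pmf p. norm (exp (t * ?X x)) \<le> exp t"
      using that by simp
  qed simp
  then show ?thesis
    using Hoeffdings_lemma_nn_integral_0[OF that mean] by (simp add: nn_integral_eq_integral)
qed

text \<open>The induction step. Both marginals are images of \<mu>, so all expectations are pulled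
  back to \<mu>, where the old exponential and the indicator of the new coordinate live on one
  space.\<close>

lemma expectation_exp_dev_marginal_Suc_le:
  fixes \<mu> :: "bool list pmf" and t :: real
  assumes supp: "set_pmf \<mu> \<subseteq> cube n" and y: "y \<in> cube n" and t: "t > 0" and k: "k < n"
    and pc: "positive_correlation \<mu> t y (Suc k)"
  shows "measure_pmf.expectation (marginal \<mu> (Suc k)) (exp_dev (marginal \<mu> (Suc k)) t (take (Suc k) y))
       \<le> exp (t\<^sup>2 / 8) * measure_pmf.expectation (marginal \<mu> k) (exp_dev (marginal \<mu> k) t (take k y))"
proof -
  let ?E = "measure_pmf.expectation \<mu>"
  have fin: "finite (set_pmf \<mu>)"
    using finite_subset[OF supp] finite_lists_length_eq[of "UNIV :: bool set" n]
    by (simp add: cube_def)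
  have int: "integrable (measure_pmf \<mu>) f" for f :: "bool list \<Rightarrow> real"
    using fin by (rule integrable_measure_pmf_finite)
  define h where "h j x = hamming (take j x) (take j y)" for j x
  define a where "a x = exp (t * (h k x - ?E (h k)))" for x
  define r :: real where "r = measure_pmf.prob \<mu> {x. x ! k \<noteq> y ! k}"
  have h_Suc: "h (Suc k) x = h k x + of_bool (x ! k \<noteq> y ! k)" if "x \<in> set_pmf \<mu>" for x
    using that supp y k unfolding h_def by (intro hamming_take_Suc) (auto simp: cube_def)
  have mean_neq: "?E (\<lambda>x. of_bool (x ! k \<noteq> y ! k)) = r"
    unfolding r_def by (rule expectation_of_bool)
  have mean_Suc: "?E (h (Suc k)) = ?E (h k) + r"
  proof -
    \<comment> \<open>The recursion \<open>h_Suc\<close> is available only on the support, hence the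
      almost-everywhere congruence.\<close>
    have "?E (h (Suc k)) = ?E (\<lambda>x. h k x + of_bool (x ! k \<noteq> y ! k))"
      by (intro integral_cong_AE) (auto simp: AE_measure_pmf_iff h_Suc)
    then show ?thesis
      using mean_neq by (simp add: int)
  qed
  have dev: "measure_pmf.expectation (marginal \<mu> j) (exp_dev (marginal \<mu> j) t (take j y))
      = ?E (\<lambda>x. exp (t * (h j x - ?E (h j))))" for j
    by (simp add: marginal_def exp_dev_def h_def[abs_def])
  have of_bool_eq: "of_bool (x ! k = y ! k) = 1 - (of_bool (x ! k \<noteq> y ! k) :: real)" for x
    by simp
  have "?E (\<lambda>x. a x * of_bool (x ! k = y ! k)) \<ge> ?E a * ?E (\<lambda>x. of_bool (x ! k = y ! k))"
  proof -
    \<comment> \<open>Used twice: \<open>g = exp_dev ...\<close> gives the correlated product, and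
      \<open>g = 1\<close> gives the mean of the conditional probability.\<close>
    have *: "measure_pmf.expectation (marginal \<mu> k) (\<lambda>x'. g x' * cond_coord \<mu> (Suc k) (y ! k) x')
        = ?E (\<lambda>x. g (take k x) * of_bool (x ! k = y ! k))" for g
      unfolding marginal_def cond_coord_def diff_Suc_1
      by (rule expectation_map_pmf_cond_prob[OF fin])
    have "exp_dev (marginal \<mu> k) t (take k y) (take k x) = a x" for x
      by (simp add: exp_dev_def marginal_def a_def h_def[abs_def])
    with pc *[of "exp_dev (marginal \<mu> k) t (take k y)"] *[of "\<lambda>_. 1"] show ?thesis
      unfolding positive_correlation_def Let_def diff_Suc_1 dev
      by (simp add: a_def[abs_def])
  qed
  \<comment> \<open>Passing to the complementary event reverses the inequality.\<close>
  then have corr: "?E (\<lambda>x. a x * of_bool (x ! k \<noteq> y ! k)) \<le> ?E a * r"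
    using mean_neq unfolding of_bool_eq by (simp add: right_diff_distrib int)
  \<comment> \<open>Any function of a Boolean is affine in its indicator. The slope factor
    \<open>exp t - 1\<close> is positive for t > 0, so \<open>corr\<close> can be multiplied by
    it.\<close>
  have affine: "exp (t * (of_bool b - r)) = exp (- (t * r)) * (1 + (exp t - 1) * of_bool b)" for b
    by (cases b) (auto simp: exp_add[symmetric] algebra_simps)
  have "?E (\<lambda>x. exp (t * (h (Suc k) x - ?E (h (Suc k)))))
      = ?E (\<lambda>x. exp (- (t * r)) * (a x + (exp t - 1) * (a x * of_bool (x ! k \<noteq> y ! k))))"
  proof (intro integral_cong_AE)
    show "AE x in measure_pmf \<mu>. exp (t * (h (Suc k) x - ?E (h (Suc k))))
      = exp (- (t * r)) * (a x + (exp t - 1) * (a x * of_bool (x ! k \<noteq> y ! k)))"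
    proof (rule AE_pmfI)
      fix x assume x: "x \<in> set_pmf \<mu>"
      have "exp (t * (h (Suc k) x - ?E (h (Suc k)))) = a x * exp (t * (of_bool (x ! k \<noteq> y ! k) - r))"
        unfolding a_def exp_add[symmetric] mean_Suc h_Suc[OF x] by (simp add: algebra_simps)
      then show "exp (t * (h (Suc k) x - ?E (h (Suc k))))
          = exp (- (t * r)) * (a x + (exp t - 1) * (a x * of_bool (x ! k \<noteq> y ! k)))"
        unfolding affine by (simp only: algebra_simps mult_1_right)
    qed
  qed auto
  also have "\<dots> = exp (- (t * r)) * (?E a + (exp t - 1) * ?E (\<lambda>x. a x * of_bool (x ! k \<noteq> y ! k)))"
    by (simp add: int)
  also have "\<dots> \<le> exp (- (t * r)) * (?E a + (exp t - 1) * (?E a * r))"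
    using corr t by (intro mult_left_mono add_left_mono) auto
  \<comment> \<open>\<open>affine\<close> read backwards: the mean of an affine function of the
    indicator depends only on r.\<close>
  also have "\<dots> = ?E a * ?E (\<lambda>x. exp (t * (of_bool (x ! k \<noteq> y ! k) - r)))"
    using mean_neq unfolding affine by (simp add: int algebra_simps)
  also have "\<dots> \<le> ?E a * exp (t\<^sup>2 / 8)"
    using exp_centred_indicator_le[OF t, of \<mu> "\<lambda>x. x ! k \<noteq> y ! k"]
    by (intro mult_left_mono) (auto simp: r_def a_def)
  finally show ?thesis
    unfolding dev by (simp add: a_def[abs_def] mult.commute)
qed

theorem theorem3:
  fixes n :: nat and \<mu> :: "bool list pmf" and t :: real and y :: "bool list"
  assumes "n \<ge> 1"
    and "set_pmf \<mu> \<subseteq> cube n"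
    and "t > 0"
    and "y \<in> cube n"
    and "\<And>k. 2 \<le> k \<Longrightarrow> k \<le> n \<Longrightarrow> positive_correlation \<mu> t y k"
  shows "measure_pmf.expectation \<mu>
           (\<lambda>x. exp (t * (hamming x y - measure_pmf.expectation \<mu> (\<lambda>z. hamming z y))))
         \<le> exp (real n * t\<^sup>2 / 2)"
proof -
  have marginal_0: "marginal \<mu> 0 = return_pmf []"
    by (simp add: marginal_def)
  have pc: "positive_correlation \<mu> t y (Suc k)" if "k < n" for k
  \<comment> \<open>The assumption starts at the second coordinate. For the first, the marginal is
    the point mass at \<open>[]\<close>, so each expectation is an evaluation there and both sides
    agree.\<close>
  proof (cases "k = 0")
    case True
    then show ?thesis
      by (simp add: positive_correlation_def marginal_0 Let_def)
  next
    case False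
    with that show ?thesis
      by (intro assms(5)) auto
  qed
  have "measure_pmf.expectation (marginal \<mu> k) (exp_dev (marginal \<mu> k) t (take k y))
      \<le> exp (real k * t\<^sup>2 / 8)" if "k \<le> n" for k
    using that
  proof (induction k)
    case 0
    then show ?case
      by (simp add: marginal_0 exp_dev_def)
  next
    case (Suc k)
    then have "measure_pmf.expectation (marginal \<mu> (Suc k))
          (exp_dev (marginal \<mu> (Suc k)) t (take (Suc k) y))
        \<le> exp (t\<^sup>2 / 8) * measure_pmf.expectation (marginal \<mu> k) (exp_dev (marginal \<mu> k) t (take k y))"
      using assms pc by (intro expectation_exp_dev_marginal_Suc_le[of \<mu> n]) auto
    also have "\<dots> \<le> exp (t\<^sup>2 / 8) * exp (real k * t\<^sup>2 / 8)"
      using Suc by (intro mult_left_mono) auto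
    also have "\<dots> = exp (real (Suc k) * t\<^sup>2 / 8)"
      by (simp add: exp_add[symmetric] field_simps)
    finally show ?case .
  qed
  from this[of n] have "measure_pmf.expectation (marginal \<mu> n) (exp_dev (marginal \<mu> n) t y)
      \<le> exp (real n * t\<^sup>2 / 8)"
    using assms(4) by (simp add: cube_def)
  \<comment> \<open>The induction yields the sharper exponent with 1/8, which is relaxed here to
    1/2.\<close>
  also have "\<dots> \<le> exp (real n * t\<^sup>2 / 2)"
    by (simp add: field_simps)
  finally have "measure_pmf.expectation (marginal \<mu> n) (exp_dev (marginal \<mu> n) t y)
      \<le> exp (real n * t\<^sup>2 / 2)" .
  moreover have "marginal \<mu> n = \<mu>"
    using assms(2) unfolding marginal_def
    by (intro map_pmf_idI) (auto simp: cube_def)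
  ultimately show ?thesis
    by (simp add: exp_dev_def[abs_def])
qed

end
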